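(* Let $n\geq 2$. Let $\mathcal{O}$ be a complete discrete valuation ring with maximal ideal $\mathfrak{p}$ and finite residue field $\mathbb{F}_q$, and let $\mathcal{O}_2=\mathcal{O}/\mathfrak{p}^2$. Assume that $x\in \mathrm{M}_n(\mathbb{F}_q)$ is in Weyr normal form. Then the map $$\rho: C_{\mathrm{SL}_n(\mathcal{O}_2)}(s(x))\longrightarrow C_{\mathrm{SL}_n(\mathbb{F}_q)}(x)$$ induced by reduction modulo the maximal ideal of $\mathcal{O}_2$ is surjective.
   Context: The map $s:\mathrm{M}_n(\mathbb{F}_q)\to \mathrm{M}_n(\mathcal{O}_2)$ is obtained by applying entrywise the multiplicative section $s:\mathbb{F}_q^{\times}\to\mathcal{O}_2^{\times}$ of the reduction map (the unique group homomorphism that is a section of reduction), with $s(0)=0$. The map $\rho$ denotes entrywise reduction $\mathrm{M}_n(\mathcal{O}_2)\to \mathrm{M}_n(\mathbb{F}_q)$ and its restrictions. For a matrix $y$ over a ring $A$, $C_{\mathrm{SL}_n(A)}(y)=\{g\in \mathrm{SL}_n(A): gy=yg\}$. Weyr form: let $A$ be a commutative ring with identity. A matrix $W\in \mathrm{M}_n(A)$ is a basic Weyr matrix with eigenvalue $\lambda\in A$ if there is a partition $n=n_1+\dots+n_r$ with $n_1\geq\dots\geq n_r\geq 1$ such that, viewing $W$ as an $r\times r$ blocked matrix $(W_{ij})$ with $W_{ij}$ of size $n_i\times n_j$: (1) $W_{ii}=\lambda I_{n_i}$ for each $i=1,\dots,r$; (2) for $i=1,\dots,r-1$, the superdiagonal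 block $W_{i,i+1}$ is the full column rank $n_i\times n_{i+1}$ matrix in reduced row-echelon form, i.e. the identity matrix $I_{n_{i+1}}$ followed by zero rows; (3) $W_{ij}=0$ when $j\notin\{i,i+1\}$. A matrix in $\mathrm{M}_n(A)$ is in Weyr (normal) form if it is a direct sum (block diagonal matrix) of basic Weyr matrices with pairwise distinct eigenvalues. *)

theory Defs
  imports
    "HOL-Algebra.Algebraic_Closure_Type"
    "HOL-Algebra.Ideal_Product"
    "HOL-Algebra.QuotRing"
    "HOL-Algebra.Ring_Divisibility"
    "Jordan_Normal_Form.Matrix"
    "Jordan_Normal_Form.Determinant"
begin

section \<open>Complete discrete valuation rings\<close>

text \<open>
  A discrete valuation ring is a local principal ideal domain that is not a field. The ring
  structure is given by a type class, so that the matrices and determinants of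
  \<open>Jordan_Normal_Form\<close> apply to its quotients, while ideals are those of \<open>HOL-Algebra\<close>, transported
  by \<open>ring_of_type_algebra\<close>.
\<close>

class discrete_valuation_ring = idom +
  assumes dvr_principal: "principal_domain (ring_of_type_algebra :: 'a ring)"
    and dvr_local: "\<exists>!I. maximalideal I (ring_of_type_algebra :: 'a ring)"
    and dvr_not_field: "\<not> Ring.field (ring_of_type_algebra :: 'a ring)"

definition (in discrete_valuation_ring) max_ideal :: "'a set" where
  "max_ideal = (THE I. maximalideal I (ring_of_type_algebra :: 'a ring))"

text \<open>Powers are taken in the semiring of ideals, whose unit is the whole ring.\<close>

definition (in discrete_valuation_ring) max_ideal_power :: "nat \<Rightarrow> 'a set" where
  "max_ideal_power k =
     max_ideal [^]\<^bsub>ideals_set (ring_of_type_algebra :: 'a ring)\<^esub> k"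

text \<open>
  Completeness in the topology defined by the powers of the maximal ideal. Limits are unique, since
  those powers have zero intersection in a discrete valuation ring.
\<close>

class complete_dvr = discrete_valuation_ring +
  assumes dvr_complete:
    "\<And>u :: nat \<Rightarrow> 'a.
       (\<forall>k. \<exists>N. \<forall>i\<ge>N. \<forall>j\<ge>N. u i - u j \<in> max_ideal_power k) \<Longrightarrow>
       \<exists>L. \<forall>k. \<exists>N. \<forall>i\<ge>N. u i - L \<in> max_ideal_power k"

lemma ideal_ring_of_typeD:
  fixes I :: "'a::comm_ring_1 set"
  assumes "ideal I (ring_of_type_algebra :: 'a ring)"
  shows "0 \<in> I" "x \<in> I \<Longrightarrow> y \<in> I \<Longrightarrow> x + y \<in> I" "x \<in> I \<Longrightarrow> r * x \<in> I"
    "x \<in> I \<Longrightarrow> - x \<in> I" "x \<in> I \<Longrightarrow> y \<in> I \<Longrightarrow> x - y \<in> I"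
proof -
  interpret ideal I "ring_of_type_algebra :: 'a ring" by fact
  show 0: "0 \<in> I" 
    using additive_subgroup.zero_closed[OF is_additive_subgroup]
    by (simp add: ring_of_type_algebra_def)
  show add: "x + y \<in> I" if "x \<in> I" "y \<in> I" for x y
    using additive_subgroup.a_closed[OF is_additive_subgroup that]
    by (simp add: ring_of_type_algebra_def)
  show mult: "r * x \<in> I" if "x \<in> I" for r x
    using I_l_closed[OF that, of r] by (simp add: ring_of_type_algebra_def)
  show neg: "- x \<in> I" if "x \<in> I" for x
    using mult[OF that, of "-1"] by simp
  show "x - y \<in> I" if "x \<in> I" "y \<in> I" for x y
    using add[OF that(1) neg[OF that(2)]] by simp
qed

lemma maximalideal_max_ideal:
  "maximalideal max_ideal (ring_of_type_algebra :: 'a::discrete_valuation_ring ring)"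
  unfolding max_ideal_def by (rule theI') (rule dvr_local)

lemma ideal_max_ideal:
  "ideal max_ideal (ring_of_type_algebra :: 'a::discrete_valuation_ring ring)"
  using maximalideal_max_ideal by (rule maximalideal.axioms)

lemma ideal_max_ideal_power:
  "ideal (max_ideal_power k) (ring_of_type_algebra :: 'a::discrete_valuation_ring ring)"
proof -
  interpret ring "ring_of_type_algebra :: 'a ring" by (rule ring_from_type_algebra)
  show ?thesis
    unfolding max_ideal_power_def
  proof (induction k)
    case 0
    then show ?case by (simp add: nat_pow_def ideals_set_def oneideal)
  next
    case (Suc k)
    then show ?case
      using ideal_prod_is_ideal[OF Suc ideal_max_ideal]
      by (simp add: nat_pow_def ideals_set_def)
  qed
qed

lemma max_ideal_power_2:
  "max_ideal_power 2 =
     ideal_prod (ring_of_type_algebra :: 'a::discrete_valuation_ring ring) max_ideal max_ideal"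
proof -
  interpret ring "ring_of_type_algebra :: 'a ring" by (rule ring_from_type_algebra)
  have "ideal_prod (ring_of_type_algebra :: 'a ring) UNIV max_ideal = max_ideal"
    using ideal_prod_one[OF ideal_max_ideal]
      cring.ideal_prod_commute[OF cring_from_type_algebra oneideal ideal_max_ideal]
    by (simp add: ring_of_type_algebra_def)
  then show ?thesis
    by (simp add: max_ideal_power_def nat_pow_def ideals_set_def numeral_2_eq_2
        ring_of_type_algebra_def)
qed

lemma max_ideal_power_2_subset: "max_ideal_power 2 \<subseteq> (max_ideal :: 'a::discrete_valuation_ring set)"
proof -
  interpret ring "ring_of_type_algebra :: 'a ring" by (rule ring_from_type_algebra)
  show ?thesis
    using ideal_prod_inter[OF ideal_max_ideal ideal_max_ideal] by (simp add: max_ideal_power_2)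
qed

lemma one_notin_max_ideal: "(1 :: 'a::discrete_valuation_ring) \<notin> max_ideal"
proof
  assume "(1 :: 'a) \<in> max_ideal"
  then have "(max_ideal :: 'a set) = UNIV"
    using ideal_ring_of_typeD(3)[OF ideal_max_ideal, of 1] by auto
  then show False
    using maximalideal.I_notcarr[OF maximalideal_max_ideal]
    by (metis partial_object.select_convs(1) ring_of_type_algebra_def)
qed

lemma max_ideal_inverse:
  fixes x :: "'a::discrete_valuation_ring"
  assumes "x \<notin> max_ideal"
  shows "\<exists>y. x * y - 1 \<in> max_ideal"
proof -
  define J where "J = {x * r + m | r m. m \<in> max_ideal}"
  note M = ideal_ring_of_typeD[OF ideal_max_ideal]
  have R: "ring (ring_of_type_algebra :: 'a ring)" by (rule ring_from_type_algebra)
  have "ideal J (ring_of_type_algebra :: 'a ring)"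
  proof (rule idealI[OF R])
    have inv: "inv\<^bsub>add_monoid ring_of_type_algebra\<^esub> a = - a" for a :: 'a
      using abelian_group.minus_equality[OF ring.is_abelian_group[OF R], of "-a" a]
      by (simp add: ring_of_type_algebra_def a_inv_def)
    show "subgroup J (add_monoid (ring_of_type_algebra :: 'a ring))"
    proof (rule group.subgroupI[OF abelian_group.a_group[OF ring.is_abelian_group[OF R]]])
      show "J \<subseteq> carrier (add_monoid ring_of_type_algebra)"
        by (simp add: ring_of_type_algebra_def)
      show "J \<noteq> {}" using M(1) by (auto simp: J_def)
    next
      fix a assume "a \<in> J"
      then obtain r m where "a = x * r + m" "m \<in> max_ideal" by (auto simp: J_def)
      then have "- a = x * (- r) + (- m)" "- m \<in> max_ideal" using M(4) by auto
      then show "inv\<^bsub>add_monoid ring_of_type_algebra\<^esub> a \<in> J"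
        unfolding inv J_def by blast
    next
      fix a b assume "a \<in> J" "b \<in> J"
      then obtain r m r' m' where "a = x * r + m" "m \<in> max_ideal" "b = x * r' + m'" "m' \<in> max_ideal"
        by (auto simp: J_def)
      then have "a + b = x * (r + r') + (m + m')" "m + m' \<in> max_ideal"
        using M(2) by (auto simp: algebra_simps)
      then have "a + b \<in> J" unfolding J_def by blast
      then show "a \<otimes>\<^bsub>add_monoid ring_of_type_algebra\<^esub> b \<in> J"
        by (simp add: ring_of_type_algebra_def)
    qed
    have *: "s * a \<in> J" if a: "a \<in> J" for a s
    proof -
      obtain r m where "a = x * r + m" "m \<in> max_ideal" using a by (auto simp: J_def)
      then have "s * a = x * (s * r) + s * m" "s * m \<in> max_ideal"
        using M(3) by (auto simp: algebra_simps)
      then show ?thesis unfolding J_def by blast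
    qed
    show "s \<otimes>\<^bsub>ring_of_type_algebra\<^esub> a \<in> J" "a \<otimes>\<^bsub>ring_of_type_algebra\<^esub> s \<in> J"
      if "a \<in> J" for a s
      using *[OF that, of s] by (simp_all add: ring_of_type_algebra_def mult.commute)
  qed
  moreover have "max_ideal \<subseteq> J"
  proof
    fix m :: 'a assume "m \<in> max_ideal"
    moreover have "m = x * 0 + m" by simp
    ultimately show "m \<in> J" unfolding J_def by blast
  qed
  moreover have "x \<in> J"
  proof -
    have "x = x * 1 + 0" by simp
    then show ?thesis unfolding J_def using M(1) by blast
  qed
  ultimately have "J = UNIV"
    using maximalideal.I_maximal[OF maximalideal_max_ideal, of J] assms
    by (auto simp: ring_of_type_algebra_def)
  then have "1 \<in> J" by simp
  then obtain r m where rm: "1 = x * r + m" "m \<in> max_ideal" by (auto simp: J_def)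
  then have "x * r - 1 = - m" by (simp add: algebra_simps)
  then have "x * r - 1 \<in> max_ideal" using M(4)[OF rm(2)] by simp
  then show ?thesis ..
qed

lemma equivp_diff_in_ideal:
  fixes I :: "'a::comm_ring_1 set"
  assumes "ideal I (ring_of_type_algebra :: 'a ring)"
  shows "equivp (\<lambda>x y. x - y \<in> I)"
proof (rule equivpI)
  note I = ideal_ring_of_typeD[OF assms]
  show "reflp (\<lambda>x y. x - y \<in> I)" using I(1) by (auto intro: reflpI)
  show "symp (\<lambda>x y. x - y \<in> I)" using I(4) by (intro sympI) (metis minus_diff_eq)
  show "transp (\<lambda>x y. x - y \<in> I)"
    using I(2) by (intro transpI) (metis diff_add_cancel add_diff_eq)
qed

lemma diff_mult_in_ideal:
  fixes I :: "'a::comm_ring_1 set"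
  assumes "ideal I (ring_of_type_algebra :: 'a ring)" "a - b \<in> I" "c - d \<in> I"
  shows "a * c - b * d \<in> I"
proof -
  note I = ideal_ring_of_typeD[OF assms(1)]
  have "a * c - b * d = c * (a - b) + b * (c - d)" by (simp add: algebra_simps)
  then show ?thesis using I(2)[OF I(3)[OF assms(2)] I(3)[OF assms(3)]] by simp
qed

lemma diff_add_in_ideal:
  fixes I :: "'a::comm_ring_1 set"
  assumes "ideal I (ring_of_type_algebra :: 'a ring)" "a - b \<in> I" "c - d \<in> I"
  shows "(a + c) - (b + d) \<in> I" "(a - c) - (b - d) \<in> I" "(- a) - (- b) \<in> I"
proof -
  note I = ideal_ring_of_typeD[OF assms(1)]
  show "(a + c) - (b + d) \<in> I" using I(2)[OF assms(2,3)] by (simp add: algebra_simps)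
  show "(a - c) - (b - d) \<in> I" using I(5)[OF assms(2,3)] by (simp add: algebra_simps)
  show "(- a) - (- b) \<in> I" using I(4)[OF assms(2)] by (simp add: algebra_simps)
qed


section \<open>The residue field and the quotient by the square of the maximal ideal\<close>

quotient_type (overloaded) 'a residue_field = "'a::discrete_valuation_ring"
  / "\<lambda>x y. x - y \<in> max_ideal"
  by (rule equivp_diff_in_ideal[OF ideal_max_ideal])

quotient_type (overloaded) 'a dvr_mod2 = "'a::discrete_valuation_ring"
  / "\<lambda>x y. x - y \<in> max_ideal_power 2"
  by (rule equivp_diff_in_ideal[OF ideal_max_ideal_power])

instantiation residue_field :: (discrete_valuation_ring) comm_ring_1
begin

lift_definition zero_residue_field :: "'a residue_field" is 0 .
lift_definition one_residue_field :: "'a residue_field" is 1 .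
lift_definition plus_residue_field :: "'a residue_field \<Rightarrow> 'a residue_field \<Rightarrow> 'a residue_field"
  is "(+)" by (rule diff_add_in_ideal(1)[OF ideal_max_ideal])
lift_definition minus_residue_field :: "'a residue_field \<Rightarrow> 'a residue_field \<Rightarrow> 'a residue_field"
  is "(-)" by (rule diff_add_in_ideal(2)[OF ideal_max_ideal])
lift_definition uminus_residue_field :: "'a residue_field \<Rightarrow> 'a residue_field"
  is uminus by (rule diff_add_in_ideal(3)[OF ideal_max_ideal])
lift_definition times_residue_field :: "'a residue_field \<Rightarrow> 'a residue_field \<Rightarrow> 'a residue_field"
  is "(*)" by (rule diff_mult_in_ideal[OF ideal_max_ideal])

instance
proof
  show "(0 :: 'a residue_field) \<noteq> 1"
    by transfer (metis diff_0_right diff_zero minus_diff_eq one_notin_max_ideal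
      ideal_ring_of_typeD(4)[OF ideal_max_ideal])
qed (transfer, simp add: algebra_simps ideal_ring_of_typeD(1)[OF ideal_max_ideal])+

end

instantiation residue_field :: (discrete_valuation_ring) field
begin

definition inverse_residue_field :: "'a residue_field \<Rightarrow> 'a residue_field" where
  "inverse (a :: 'a residue_field) = (if a = 0 then 0 else (SOME b. a * b = 1))"

definition divide_residue_field :: "'a residue_field \<Rightarrow> 'a residue_field \<Rightarrow> 'a residue_field" where
  "(a :: 'a residue_field) div b = a * inverse b"

instance
proof
  fix a b :: "'a residue_field"
  show "inverse a * a = 1" if "a \<noteq> 0"
  proof -
    have "\<exists>b. a * b = 1" using that by transfer (simp add: max_ideal_inverse)
    then have "a * (SOME b. a * b = 1) = 1" by (rule someI_ex)
    then show ?thesis using that by (simp add: inverse_residue_field_def mult.commute)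
  qed
qed (simp_all add: inverse_residue_field_def divide_residue_field_def)

end

instantiation dvr_mod2 :: (discrete_valuation_ring) comm_ring_1
begin

lift_definition zero_dvr_mod2 :: "'a dvr_mod2" is 0 .
lift_definition one_dvr_mod2 :: "'a dvr_mod2" is 1 .
lift_definition plus_dvr_mod2 :: "'a dvr_mod2 \<Rightarrow> 'a dvr_mod2 \<Rightarrow> 'a dvr_mod2"
  is "(+)" by (rule diff_add_in_ideal(1)[OF ideal_max_ideal_power])
lift_definition minus_dvr_mod2 :: "'a dvr_mod2 \<Rightarrow> 'a dvr_mod2 \<Rightarrow> 'a dvr_mod2"
  is "(-)" by (rule diff_add_in_ideal(2)[OF ideal_max_ideal_power])
lift_definition uminus_dvr_mod2 :: "'a dvr_mod2 \<Rightarrow> 'a dvr_mod2"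
  is uminus by (rule diff_add_in_ideal(3)[OF ideal_max_ideal_power])
lift_definition times_dvr_mod2 :: "'a dvr_mod2 \<Rightarrow> 'a dvr_mod2 \<Rightarrow> 'a dvr_mod2"
  is "(*)" by (rule diff_mult_in_ideal[OF ideal_max_ideal_power])

instance
proof
  have "(1 :: 'a) \<notin> max_ideal_power 2"
    using one_notin_max_ideal max_ideal_power_2_subset by blast
  then show "(0 :: 'a dvr_mod2) \<noteq> 1"
    by transfer (metis diff_0_right diff_zero minus_diff_eq
      ideal_ring_of_typeD(4)[OF ideal_max_ideal_power])
qed (transfer, simp add: algebra_simps ideal_ring_of_typeD(1)[OF ideal_max_ideal_power])+

end

lift_definition reduction :: "'a::discrete_valuation_ring dvr_mod2 \<Rightarrow> 'a residue_field"
  is "\<lambda>x. x" using max_ideal_power_2_subset by blast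

lemma reduction_hom:
  "reduction 0 = 0" "reduction 1 = 1"
  "reduction (a + b) = reduction a + reduction b"
  "reduction (a * b) = reduction a * reduction b"
  by (transfer, simp add: ideal_ring_of_typeD(1)[OF ideal_max_ideal])+


lemma reduction_power: "reduction (a ^ k) = reduction a ^ k"
  by (induction k) (simp_all add: reduction_hom)

lemma reduction_of_nat: "reduction (of_nat k) = of_nat k"
  by (induction k) (simp_all add: reduction_hom)

lemma surj_reduction: "\<exists>b. reduction b = a"
  by transfer (metis cancel_comm_monoid_add_class.diff_cancel
    ideal_ring_of_typeD(1)[OF ideal_max_ideal])

lemma reduction_kernel_mult:
  assumes "reduction a = 0" "reduction b = 0"
  shows "a * b = 0"
  using assms
proof transfer
  fix a b :: 'a
  assume "a - 0 \<in> max_ideal" "b - 0 \<in> max_ideal"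
  then show "a * b - 0 \<in> max_ideal_power 2"
    unfolding max_ideal_power_2
    using ideal_prod.prod[of a max_ideal b max_ideal ring_of_type_algebra]
    by (simp add: ring_of_type_algebra_def)
qed


section \<open>The multiplicative section of the reduction map\<close>

text \<open>
  A group homomorphism from the units of the residue field to the units of the quotient by the
  square of the maximal ideal which is a section of the reduction map, extended by zero.
\<close>

definition mult_section ::
    "('a::discrete_valuation_ring residue_field \<Rightarrow> 'a dvr_mod2) \<Rightarrow> bool" where
  "mult_section f \<longleftrightarrow>
     f 0 = 0 \<and>
     (\<forall>a. a \<noteq> 0 \<longrightarrow> f a dvd 1) \<and>
     (\<forall>a b. a \<noteq> 0 \<longrightarrow> b \<noteq> 0 \<longrightarrow> f (a * b) = f a * f b) \<and>
     (\<forall>a. a \<noteq> 0 \<longrightarrow> reduction (f a) = a)"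

text \<open>
  For a finite residue field, the section exists and is unique: see \<open>ex1_mult_section\<close> below.
\<close>

definition the_section :: "'a::discrete_valuation_ring residue_field \<Rightarrow> 'a dvr_mod2" where
  "the_section = (THE f. mult_section f)"

lemma finite_field_facts:
  fixes a :: "'k::field"
  assumes fin: "finite (UNIV :: 'k set)"
  shows "of_nat (card (UNIV :: 'k set)) = (0 :: 'k)" "a ^ card (UNIV :: 'k set) = a"
proof -
  have "(\<Sum>y\<in>UNIV. y + 1) = (\<Sum>y\<in>UNIV. y :: 'k)"
    by (rule sum.reindex_bij_witness[of _ "\<lambda>y. y - 1" "\<lambda>y. y + 1"]) auto
  then show "of_nat (card (UNIV :: 'k set)) = (0 :: 'k)"
    by (simp add: sum.distrib)
  show "a ^ card (UNIV :: 'k set) = a"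
  proof (cases "a = 0")
    case True
    then show ?thesis using fin by (simp add: card_gt_0_iff power_0_left)
  next
    case False
    have "(\<Prod>y\<in>UNIV-{0}. a * y) = (\<Prod>y\<in>UNIV-{0}. y)"
      by (rule prod.reindex_bij_witness[of _ "\<lambda>y. y / a" "\<lambda>y. a * y"]) (use False in auto)
    moreover have "(\<Prod>y\<in>UNIV-{0}. y) \<noteq> (0 :: 'k)" using fin by (simp add: prod_zero_iff)
    ultimately have "a ^ card (UNIV - {0 :: 'k}) = 1" by (simp add: prod.distrib)
    moreover have "card (UNIV :: 'k set) = Suc (card (UNIV - {0 :: 'k}))"
      using card.remove[OF fin, of 0] by simp
    ultimately show ?thesis by (simp only: power_Suc mult_1_right)
  qed
qed

lemma power_card_cong:
  fixes a b :: "'a::discrete_valuation_ring dvr_mod2"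
  assumes fin: "finite (UNIV :: 'a residue_field set)" and "reduction a = reduction b"
  shows "a ^ card (UNIV :: 'a residue_field set) = b ^ card (UNIV :: 'a residue_field set)"
proof -
  define d where "d = a - b"
  have a: "a = b + d" by (simp add: d_def)
  have d: "reduction d = 0"
    using reduction_hom(3)[of b d] assms(2) by (simp add: a)
  have dd: "d * d = 0" using reduction_kernel_mult[OF d d] .
  have step: "(b + d) * (b * p + c * d * p) = b * (b * p) + (1 + c) * d * (b * p) + c * (d * d) * p"
    for p c by (simp add: algebra_simps)
  have expand: "(b + d) ^ Suc k = b ^ Suc k + of_nat (Suc k) * d * b ^ k" for k
  proof (induction k)
    case (Suc k)
    have "(b + d) ^ Suc (Suc k) = (b + d) * (b ^ Suc k + of_nat (Suc k) * d * b ^ k)"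
      using Suc by simp
    also have "\<dots> = b ^ Suc (Suc k) + of_nat (Suc (Suc k)) * d * b ^ Suc k"
      unfolding power_Suc step dd by simp
    finally show ?case .
  qed simp
  obtain k where k: "card (UNIV :: 'a residue_field set) = Suc k"
    using fin by (metis UNIV_not_empty card_gt_0_iff gr0_implies_Suc)
  have "reduction (of_nat (Suc k) :: 'a dvr_mod2) = 0"
    using finite_field_facts(1)[OF fin] by (simp only: reduction_of_nat k)
  then have "of_nat (Suc k) * d = 0" using d by (rule reduction_kernel_mult)
  then show ?thesis unfolding k a expand by (simp only: mult_zero_left add_0_right)
qed

lemma ex1_mult_section:
  assumes fin: "finite (UNIV :: 'a::discrete_valuation_ring residue_field set)"
  shows "\<exists>!f :: 'a residue_field \<Rightarrow> 'a dvr_mod2. mult_section f"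
proof
  define q where "q = card (UNIV :: 'a residue_field set)"
  define l :: "'a residue_field \<Rightarrow> 'a dvr_mod2" where "l a = (SOME b. reduction b = a)" for a
  have l: "reduction (l a) = a" for a unfolding l_def using someI_ex[OF surj_reduction] .
  have q: "q > 0" using fin by (simp add: q_def card_gt_0_iff)
  have frob: "a ^ q = a" for a :: "'a residue_field"
    unfolding q_def by (rule finite_field_facts(2)[OF fin])
  have cong: "a ^ q = b ^ q" if "reduction a = reduction b" for a b :: "'a dvr_mod2"
    unfolding q_def by (rule power_card_cong[OF fin that])
  define f where "f a = l a ^ q" for a
  have f0: "f 0 = 0"
    using cong[of "l 0" 0] q by (simp add: f_def l reduction_hom power_0_left)
  have f1: "f 1 = 1"
    using cong[of "l 1" 1] by (simp add: f_def l reduction_hom)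
  have mult: "f (a * b) = f a * f b" for a b
    using cong[of "l (a * b)" "l a * l b"]
    by (simp add: f_def l reduction_hom power_mult_distrib)
  have unit: "f a dvd 1" if "a \<noteq> 0" for a
    using mult[of a "inverse a"] that f1 by (metis dvdI right_inverse)
  have red: "reduction (f a) = a" for a by (simp add: f_def reduction_power l frob)
  show "mult_section f" unfolding mult_section_def using f0 mult unit red by blast
  fix g :: "'a residue_field \<Rightarrow> 'a dvr_mod2"
  assume g: "mult_section g"
  show "g = f"
  proof
    fix a show "g a = f a"
    proof (cases "a = 0")
      case True
      then show ?thesis using g f0 by (simp add: mult_section_def)
    next
      case False
      have "g (a ^ Suc k) = g a ^ Suc k" for k
        using g False by (induction k) (auto simp: mult_section_def)
      then have "g (a ^ q) = g a ^ q" using q by (metis gr0_implies_Suc)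
      moreover have "g a ^ q = l a ^ q" using g False l by (intro cong) (auto simp: mult_section_def)
      ultimately show ?thesis by (simp add: frob f_def)
    qed
  qed
qed

lemma mult_section_the_section:
  assumes "finite (UNIV :: 'a::discrete_valuation_ring residue_field set)"
  shows "mult_section (the_section :: 'a residue_field \<Rightarrow> 'a dvr_mod2)"
  unfolding the_section_def by (rule theI'[OF ex1_mult_section[OF assms]])


section \<open>Weyr normal form\<close>

text \<open>Blocks are indexed from 0, with block sizes given by the list \<open>ns\<close>.\<close>

definition mat_block :: "nat list \<Rightarrow> 'a mat \<Rightarrow> nat \<Rightarrow> nat \<Rightarrow> 'a mat" where
  "mat_block ns W i j =
     mat (ns ! i) (ns ! j)
       (\<lambda>(a, b). W $$ (sum_list (take i ns) + a, sum_list (take j ns) + b))"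

definition basic_weyr :: "'a::comm_ring_1 \<Rightarrow> 'a mat \<Rightarrow> bool" where
  "basic_weyr c W \<longleftrightarrow>
     (\<exists>ns. ns \<noteq> [] \<and> sorted_wrt (\<ge>) ns \<and> (\<forall>m\<in>set ns. m \<ge> 1) \<and>
       W \<in> carrier_mat (sum_list ns) (sum_list ns) \<and>
       (\<forall>i<length ns. mat_block ns W i i = c \<cdot>\<^sub>m 1\<^sub>m (ns ! i)) \<and>
       (\<forall>i. Suc i < length ns \<longrightarrow>
         mat_block ns W i (Suc i) =
           1\<^sub>m (ns ! Suc i) @\<^sub>r 0\<^sub>m (ns ! i - ns ! Suc i) (ns ! Suc i)) \<and>
       (\<forall>i<length ns. \<forall>j<length ns. j \<notin> {i, Suc i} \<longrightarrow>
         mat_block ns W i j = 0\<^sub>m (ns ! i) (ns ! j)))"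

definition weyr_form :: "'a::comm_ring_1 mat \<Rightarrow> bool" where
  "weyr_form A \<longleftrightarrow>
     (\<exists>cs Ws. list_all2 basic_weyr cs Ws \<and> distinct cs \<and> A = diag_block_mat Ws)"


section \<open>Centralizers in the special linear group\<close>

definition SL_centralizer :: "nat \<Rightarrow> 'a::comm_ring_1 mat \<Rightarrow> 'a mat set" where
  "SL_centralizer n y = {g \<in> carrier_mat n n. det g = 1 \<and> g * y = y * g}"

end

theory Submission
  imports Defs
begin

text \<open>
  A matrix in Weyr form is, up to a permutation of the basis, in Jordan form: the basis vectors are
  arranged in chains, every vector lies in some layer of its chain, and the matrix acts on a chain
  by a scalar (its eigenvalue, or colour) plus the shift from each layer to the one below. So the
  off-diagonal entries are 0 or 1, with at most one 1 in every row and column.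

  Let \<open>g\<close> be a matrix over the residue field that commutes with such an \<open>x\<close>. The equation
  \<open>g x = x g\<close> only says that certain entries of \<open>g\<close> vanish and that certain entries coincide.
  Both properties survive any entrywise map that fixes 0. Hence the entrywise lift \<open>s(g)\<close> commutes
  with \<open>s(x)\<close> (\<open>entrywise_lift_commutes\<close>), and only its determinant \<open>d\<close>, which reduces to 1 if
  \<open>det g = 1\<close>, may have to be corrected. Since the kernel of reduction has square zero, a power
  \<open>(1 + e) ^ r\<close> with \<open>e\<close> in the kernel equals \<open>1 + r e\<close>. There are two cases.

  Suppose that some chain has a length \<open>r\<close> that is nonzero in the residue field. Then \<open>1/d\<close> is the
  \<open>r\<close>-th power of some \<open>u\<close> that reduces to 1. Scaling the chain by \<open>u\<close> commutes with \<open>s(x)\<close>,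
  reduces to the identity and has determinant \<open>u ^ r\<close>, so it repairs the determinant.

  Otherwise the characteristic \<open>p\<close> divides the length of every chain, and \<open>d\<close> is already 1: the
  lift is block triangular with respect to the layers, and its diagonal blocks on the layers \<open>i\<close> and
  \<open>i + 1\<close> agree unless a chain ends at layer \<open>i\<close>, which forces \<open>p\<close> to divide \<open>i + 1\<close>. The
  determinant of the lift is therefore a \<open>p\<close>-th power \<open>e ^ p\<close> (\<open>det_eq_power\<close>). Such a power
  depends only on the reduction of \<open>e\<close>, so \<open>d\<close> is the image under \<open>s\<close> of its own reduction,
  namely \<open>s(1) = 1\<close>.
\<close>

section \<open>Determinants over finite sets of indices\<close>

text \<open>
  The layers of a matrix are not intervals of indices, so their blocks are handled as determinants
  indexed by arbitrary finite sets.
\<close>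

definition set_det :: "nat set \<Rightarrow> (nat \<Rightarrow> nat \<Rightarrow> 'r::comm_ring_1) \<Rightarrow> 'r" where
  "set_det S A = (\<Sum>p | p permutes S. signof p * (\<Prod>k\<in>S. A k (p k)))"

lemma det_eq_set_det:
  assumes "A \<in> carrier_mat n n"
  shows "det A = set_det {..<n} (\<lambda>k l. A $$ (k, l))"
  using assms by (simp add: det_def' set_det_def atLeast0LessThan)

text \<open>
  A permutation contributes to the left-hand side only if it maps \<open>T\<close> into itself. As \<open>T\<close> is
  finite, it then preserves both \<open>S\<close> and \<open>T\<close>, and so is the product of a permutation of \<open>S\<close> and a
  permutation of \<open>T\<close>.
\<close>

lemma set_det_block_triangular:
  fixes A :: "nat \<Rightarrow> nat \<Rightarrow> 'r::comm_ring_1"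
  assumes fin: "finite S" "finite T" and disj: "S \<inter> T = {}"
    and zero: "\<And>k l. k \<in> T \<Longrightarrow> l \<in> S \<Longrightarrow> A k l = 0"
  shows "set_det (S \<union> T) A = set_det S A * set_det T A"
proof -
  define P where "P = {p. p permutes (S \<union> T) \<and> p ` T \<subseteq> T}"
  have PS: "p ` S = S" and PT: "p ` T = T" if "p \<in> P" for p
  proof -
    have p: "p permutes (S \<union> T)" "p ` T \<subseteq> T" using that by (auto simp: P_def)
    show T: "p ` T = T"
      by (rule card_subset_eq[OF fin(2) p(2)])
        (simp add: card_image permutes_inj_on[OF p(1)])
    have "p ` (S \<union> T) = S \<union> T" by (rule permutes_image[OF p(1)])
    moreover have "p ` S \<inter> p ` T = {}"
      using disj by (simp add: image_Int[OF permutes_inj[OF p(1)], symmetric])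
    ultimately show "p ` S = S" using T disj by (auto simp: image_Un)
  qed
  have split: "p \<circ> q \<in> P" "restrict_id (p \<circ> q) S = p" "restrict_id (p \<circ> q) T = q"
    if p: "p permutes S" and q: "q permutes T" for p q
  proof -
    have pT: "p k = k" if "k \<in> T" for k using that p disj by (metis disjoint_iff permutes_not_in)
    have qS: "q k = k" if "k \<in> S" for k using that q disj by (metis disjoint_iff permutes_not_in)
    have qT: "q k \<in> T" if "k \<in> T" for k using that q by (simp add: permutes_in_image)
    have "p permutes (S \<union> T)" "q permutes (S \<union> T)"
      using p q by (auto intro: permutes_subset)
    then have "p \<circ> q permutes (S \<union> T)" by (intro permutes_compose)
    then show "p \<circ> q \<in> P" using pT qT by (auto simp: P_def)
    show "restrict_id (p \<circ> q) S = p"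
      using qS p by (auto simp: restrict_id_def fun_eq_iff permutes_not_in)
    show "restrict_id (p \<circ> q) T = q"
      using pT qT q by (auto simp: restrict_id_def fun_eq_iff permutes_not_in)
  qed
  have join: "restrict_id r S permutes S" "restrict_id r T permutes T"
    "restrict_id r S \<circ> restrict_id r T = r" if r: "r \<in> P" for r
  proof -
    have rp: "r permutes (S \<union> T)" using r by (simp add: P_def)
    show "restrict_id r S permutes S" "restrict_id r T permutes T"
      using PS[OF r] PT[OF r] permutes_inj_on[OF rp]
      by (auto intro!: permutes_restrict_id simp: bij_betw_def)
    show "restrict_id r S \<circ> restrict_id r T = r"
    proof
      fix k
      have "r k \<notin> S" if "k \<in> T" using PT[OF r] that disj by blast
      moreover have "r k = k" if "k \<notin> S" "k \<notin> T" using permutes_not_in[OF rp] that by blast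
      ultimately show "(restrict_id r S \<circ> restrict_id r T) k = r k"
        using disj by (auto simp: restrict_id_def)
    qed
  qed
  have "set_det (S \<union> T) A = (\<Sum>p\<in>P. signof p * (\<Prod>k\<in>S\<union>T. A k (p k)))"
    unfolding set_det_def
  proof (rule sum.mono_neutral_right)
    show "finite {p. p permutes S \<union> T}" using fin by (intro finite_permutations) auto
    show "P \<subseteq> {p. p permutes S \<union> T}" by (auto simp: P_def)
    show "\<forall>p\<in>{p. p permutes S \<union> T} - P. signof p * (\<Prod>k\<in>S\<union>T. A k (p k)) = 0"
    proof
      fix p assume p: "p \<in> {p. p permutes S \<union> T} - P"
      then obtain k where k: "k \<in> T" "p k \<notin> T" by (auto simp: P_def)
      then have "p k \<in> S" using p permutes_in_image[of p "S \<union> T" k] by auto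
      then have "A k (p k) = 0" using k(1) zero by blast
      then have "(\<Prod>k\<in>S\<union>T. A k (p k)) = 0" using fin k(1) by (intro prod_zero) auto
      then show "signof p * (\<Prod>k\<in>S\<union>T. A k (p k)) = 0" by simp
    qed
  qed
  also have "\<dots> = (\<Sum>(p, q)\<in>{p. p permutes S} \<times> {q. q permutes T}.
      (signof p * (\<Prod>k\<in>S. A k (p k))) * (signof q * (\<Prod>k\<in>T. A k (q k))))"
  proof (rule sum.reindex_bij_witness[of _ "\<lambda>(p, q). p \<circ> q"
        "\<lambda>r. (restrict_id r S, restrict_id r T)"])
    fix r assume r: "r \<in> P"
    have "signof r = (signof (restrict_id r S) * signof (restrict_id r T) :: 'r)"
    proof -
      have "permutation (restrict_id r S)" "permutation (restrict_id r T)"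
        using join[OF r] fin by (auto intro: permutes_imp_permutation)
      from sign_compose[OF this] show ?thesis using join(3)[OF r] by simp
    qed
    then show "(case (restrict_id r S, restrict_id r T) of (p, q) \<Rightarrow>
        (signof p * (\<Prod>k\<in>S. A k (p k))) * (signof q * (\<Prod>k\<in>T. A k (q k)))) =
        signof r * (\<Prod>k\<in>S\<union>T. A k (r k))"
      using fin disj by (simp add: prod.union_disjoint)
  qed (use split join in auto)
  also have "\<dots> = set_det S A * set_det T A"
    by (simp add: set_det_def sum_product sum.cartesian_product)
  finally show ?thesis .
qed

lemma set_det_layers:
  fixes A :: "nat \<Rightarrow> nat \<Rightarrow> 'r::comm_ring_1"
  assumes "finite S"
    and "\<And>k l. k \<in> S \<Longrightarrow> l \<in> S \<Longrightarrow> f l < (f k :: nat) \<Longrightarrow> A k l = 0"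
    and "\<And>k. k \<in> S \<Longrightarrow> f k < r"
  shows "set_det S A = (\<Prod>i<r. set_det {k \<in> S. f k = i} A)"
  using assms
proof (induction r arbitrary: S)
  case 0
  then have "S = {}" by auto
  then show ?case by (simp add: set_det_def)
next
  case (Suc r)
  have S: "S = {k \<in> S. f k < r} \<union> {k \<in> S. f k = r}" using Suc.prems(3) by force
  have "set_det S A = set_det {k \<in> S. f k < r} A * set_det {k \<in> S. f k = r} A"
    by (subst S, rule set_det_block_triangular) (use Suc.prems in auto)
  also have "set_det {k \<in> S. f k < r} A =
      (\<Prod>i<r. set_det {k \<in> {k \<in> S. f k < r}. f k = i} A)"
    by (rule Suc.IH) (use Suc.prems in auto)
  also have "\<dots> = (\<Prod>i<r. set_det {k \<in> S. f k = i} A)"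
    by (intro prod.cong refl arg_cong2[where f = set_det]) auto
  finally show ?case by simp
qed

lemma set_det_reindex:
  fixes A :: "nat \<Rightarrow> nat \<Rightarrow> 'r::comm_ring_1"
  assumes "finite S" and h: "bij_betw h S T"
    and eq: "\<And>k l. k \<in> S \<Longrightarrow> l \<in> S \<Longrightarrow> A (h k) (h l) = B k l"
  shows "set_det T A = set_det S B"
proof -
  have inj: "inj_on h S" and T: "T = h ` S" using h by (auto simp: bij_betw_def)
  have hinv: "bij_betw (inv_into S h) T S" by (rule bij_betw_inv_into[OF h])
  have "set_det S B =
      (\<Sum>p | p permutes T. signof p * (\<Prod>k\<in>T. A k (p k)))"
    unfolding set_det_def
  proof (rule sum.reindex_bij_witness[of _ "map_permutation T (inv_into S h)" "map_permutation S h"])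
    fix p assume "p \<in> {p. p permutes S}"
    then have p: "p permutes S" by simp
    show "map_permutation T (inv_into S h) (map_permutation S h p) = p"
      by (rule map_permutation_compose_inv[OF h p]) (simp add: inj)
    show "map_permutation S h p \<in> {p. p permutes T}"
      using map_permutation_permutes[OF h p] by simp
    have "(\<Prod>k\<in>T. A k (map_permutation S h p k)) = (\<Prod>k\<in>S. A (h k) (map_permutation S h p (h k)))"
      by (simp add: T prod.reindex[OF inj])
    also have "\<dots> = (\<Prod>k\<in>S. B k (p k))"
      by (rule prod.cong) (simp_all add: map_permutation_apply[OF inj] eq permutes_in_image[OF p])
    finally show "signof (map_permutation S h p) * (\<Prod>k\<in>T. A k (map_permutation S h p k)) =
        signof p * (\<Prod>k\<in>S. B k (p k))"
      by (simp add: sign_map_permutation[OF inj p assms(1)])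
  next
    fix p assume "p \<in> {p. p permutes T}"
    then have p: "p permutes T" by simp
    show "map_permutation S h (map_permutation T (inv_into S h) p) = p"
      by (rule map_permutation_compose_inv[OF hinv p]) (simp add: T f_inv_into_f)
    show "map_permutation T (inv_into S h) p \<in> {p. p permutes S}"
      using map_permutation_permutes[OF hinv p] by simp
  qed
  then show ?thesis by (simp add: set_det_def)
qed

section \<open>Matrices acting on labelled chains\<close>

definition next_in_chain :: "(nat \<Rightarrow> nat) \<Rightarrow> (nat \<Rightarrow> nat) \<Rightarrow> nat \<Rightarrow> nat \<Rightarrow> bool" where
  "next_in_chain chain layer k l \<longleftrightarrow> chain l = chain k \<and> layer l = Suc (layer k)"

text \<open>
  This is a Jordan matrix with its basis permuted. Eigenvalues are attached to chains, and distinct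
  chains may share one.
\<close>

definition chain_mat ::
    "nat \<Rightarrow> (nat \<Rightarrow> nat) \<Rightarrow> (nat \<Rightarrow> nat) \<Rightarrow> (nat \<Rightarrow> 'r::comm_ring_1) \<Rightarrow> 'r mat" where
  "chain_mat n chain layer c = mat n n (\<lambda>(k, l).
     if k = l then c (chain k) else if next_in_chain chain layer k l then 1 else 0)"

lemma chain_mat_carrier [simp]: "chain_mat n chain layer c \<in> carrier_mat n n"
  by (simp add: chain_mat_def)

lemma sum_lift_subsingleton:
  assumes "s 0 = 0" "S = {} \<or> (\<exists>m. S = {m})"
  shows "(\<Sum>m\<in>S. s (f m)) = s (\<Sum>m\<in>S. f m)"
  using assms by auto

text \<open>
  The layers that occur in a chain form an initial segment of the natural numbers, with one basis
  index for each of them.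
\<close>

locale chain_labelling =
  fixes n :: nat and chain layer :: "nat \<Rightarrow> nat"
  assumes label_inj:
      "k < n \<Longrightarrow> l < n \<Longrightarrow> chain k = chain l \<Longrightarrow> layer k = layer l \<Longrightarrow> k = l"
    and layer_down:
      "k < n \<Longrightarrow> layer k = Suc i \<Longrightarrow> \<exists>l<n. chain l = chain k \<and> layer l = i"
begin

abbreviation nxt :: "nat \<Rightarrow> nat \<Rightarrow> bool" where
  "nxt \<equiv> next_in_chain chain layer"

lemma nxt_source_unique: "k < n \<Longrightarrow> k' < n \<Longrightarrow> nxt k l \<Longrightarrow> nxt k' l \<Longrightarrow> k = k'"
  by (rule label_inj) (auto simp: next_in_chain_def)

lemma nxt_target_unique: "l < n \<Longrightarrow> l' < n \<Longrightarrow> nxt k l \<Longrightarrow> nxt k l' \<Longrightarrow> l = l'"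
  by (rule label_inj) (auto simp: next_in_chain_def)

lemma sum_sources_lift:
  assumes "s 0 = 0"
  shows "(\<Sum>m | m < n \<and> nxt m l. s (f m)) = s (\<Sum>m | m < n \<and> nxt m l. f m)"
proof -
  have "{m. m < n \<and> nxt m l} = {} \<or> (\<exists>m. {m. m < n \<and> nxt m l} = {m})"
    using nxt_source_unique by blast
  then show ?thesis by (rule sum_lift_subsingleton[where s = s, OF assms])
qed

lemma sum_targets_lift:
  assumes "s 0 = 0"
  shows "(\<Sum>m | m < n \<and> nxt k m. s (f m)) = s (\<Sum>m | m < n \<and> nxt k m. f m)"
proof -
  have "{m. m < n \<and> nxt k m} = {} \<or> (\<exists>m. {m. m < n \<and> nxt k m} = {m})"
    using nxt_target_unique by blast
  then show ?thesis by (rule sum_lift_subsingleton[where s = s, OF assms])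
qed

lemma mult_chain_mat_index:
  assumes g: "g \<in> carrier_mat n n" and kl: "k < n" "l < n"
  shows "(g * chain_mat n chain layer c) $$ (k, l) =
    g $$ (k, l) * c (chain l) + (\<Sum>m | m < n \<and> nxt m l. g $$ (k, m))"
proof -
  have "(g * chain_mat n chain layer c) $$ (k, l) = (\<Sum>m<n. g $$ (k, m) *
      (if m = l then c (chain m) else if nxt m l then 1 else 0))"
    using g kl by (simp add: scalar_prod_def chain_mat_def atLeast0LessThan)
  also have "\<dots> = (\<Sum>m<n. (if m = l then g $$ (k, l) * c (chain l) else 0) +
      (if nxt m l then g $$ (k, m) else 0))"
    by (rule sum.cong) (auto simp: next_in_chain_def)
  also have "\<dots> = g $$ (k, l) * c (chain l) + (\<Sum>m | m < n \<and> nxt m l. g $$ (k, m))"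
    using kl by (simp add: sum.distrib sum.inter_filter[symmetric])
  finally show ?thesis .
qed

lemma chain_mat_mult_index:
  assumes g: "g \<in> carrier_mat n n" and kl: "k < n" "l < n"
  shows "(chain_mat n chain layer c * g) $$ (k, l) =
    g $$ (k, l) * c (chain k) + (\<Sum>m | m < n \<and> nxt k m. g $$ (m, l))"
proof -
  have "(chain_mat n chain layer c * g) $$ (k, l) = (\<Sum>m<n. 
      (if k = m then c (chain k) else if nxt k m then 1 else 0) * g $$ (m, l))"
    using g kl by (simp add: scalar_prod_def chain_mat_def atLeast0LessThan)
  also have "\<dots> = (\<Sum>m<n. (if m = k then g $$ (k, l) * c (chain k) else 0) +
      (if nxt k m then g $$ (m, l) else 0))"
    by (rule sum.cong) (auto simp: next_in_chain_def)
  also have "\<dots> = g $$ (k, l) * c (chain k) + (\<Sum>m | m < n \<and> nxt k m. g $$ (m, l))"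
    using kl by (simp add: sum.distrib sum.inter_filter[symmetric])
  finally show ?thesis .
qed

lemma commutes_iff:
  assumes g: "g \<in> carrier_mat n n"
  shows "g * chain_mat n chain layer c = chain_mat n chain layer c * g \<longleftrightarrow>
    (\<forall>k<n. \<forall>l<n. g $$ (k, l) * c (chain l) + (\<Sum>m | m < n \<and> nxt m l. g $$ (k, m)) =
      g $$ (k, l) * c (chain k) + (\<Sum>m | m < n \<and> nxt k m. g $$ (m, l)))"
    (is "?L = ?R \<longleftrightarrow> _")
proof -
  have "?L \<in> carrier_mat n n" "?R \<in> carrier_mat n n"
    using g by (auto intro!: mult_carrier_mat)
  then have "?L = ?R \<longleftrightarrow> (\<forall>k<n. \<forall>l<n. ?L $$ (k, l) = ?R $$ (k, l))"
    by (metis carrier_matD eq_matI)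
  then show ?thesis using g by (simp add: mult_chain_mat_index chain_mat_mult_index)
qed

text \<open>
  A finite set of natural numbers that is closed under predecessors is the initial segment given by
  its cardinality.
\<close>

lemma layers_of_chain:
  "layer ` {k. k < n \<and> chain k = a} = {..<card {k. k < n \<and> chain k = a}}"
proof -
  let ?C = "{k. k < n \<and> chain k = a}" and ?X = "layer ` {k. k < n \<and> chain k = a}"
  have inj: "inj_on layer ?C" using label_inj by (auto simp: inj_on_def)
  have fin: "finite ?X" by simp
  have down: "i \<in> ?X" if Suc: "Suc i \<in> ?X" for i
  proof -
    obtain k where k: "k < n" "chain k = a" "layer k = Suc i"
      using Suc by (elim imageE) auto
    obtain l where l: "l < n" "chain l = a" "layer l = i"
      using layer_down[OF k(1,3)] k(2) by metis
    show ?thesis by (rule image_eqI[of _ _ l]) (use l in auto)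
  qed
  define m where "m = (LEAST m. m \<notin> ?X)"
  have "\<exists>m. m \<notin> ?X" using fin by (metis ex_new_if_finite infinite_UNIV_nat)
  then have m: "m \<notin> ?X" unfolding m_def by (rule LeastI_ex)
  have below: "i \<in> ?X" if "i < m" for i using not_less_Least[of i "\<lambda>m. m \<notin> ?X"] that by (auto simp: m_def)
  have "m + i \<notin> ?X" for i
    using m down by (induction i) auto
  then have "?X = {..<m}" using below by (metis (no_types, lifting) lessThan_iff subsetI subset_antisym nat_le_iff_add not_less)
  moreover have "card ?X = card ?C" by (rule card_image[OF inj])
  ultimately show ?thesis by simp
qed

lemma bounded_layers: "\<exists>b. \<forall>k<n. layer k < b"
proof -
  have "finite (layer ` {..<n})" by simp
  then show ?thesis by (metis finite_nat_set_iff_bounded imageI lessThan_iff)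
qed

lemma commuting_entry_eq:
  assumes "g \<in> carrier_mat n n" "g * chain_mat n chain layer c = chain_mat n chain layer c * g"
    and "k < n" "l < n"
  shows "g $$ (k, l) * c (chain l) + (\<Sum>m | m < n \<and> nxt m l. g $$ (k, m)) =
    g $$ (k, l) * c (chain k) + (\<Sum>m | m < n \<and> nxt k m. g $$ (m, l))"
  using assms commutes_iff by blast

text \<open>
  A commuting matrix preserves the generalised eigenspaces. The entry equation expresses
  \<open>g\<^sub>k\<^sub>l\<close>, up to the nonzero difference of the two eigenvalues, through entries with the same colours
  that lie one layer higher in the row or one layer lower in the column. This recursion ends because
  the layers are bounded.
\<close>

lemma commuting_zero_colour:
  fixes c :: "nat \<Rightarrow> 'k::field"
  assumes g: "g \<in> carrier_mat n n" "g * chain_mat n chain layer c = chain_mat n chain layer c * g"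
    and "k < n" "l < n" "c (chain k) \<noteq> c (chain l)"
  shows "g $$ (k, l) = 0"
proof -
  obtain b where b: "\<And>k. k < n \<Longrightarrow> layer k < b" using bounded_layers by blast
  show ?thesis
    using assms(3-5)
  proof (induction "(b - layer k) + layer l" arbitrary: k l rule: less_induct)
    case less
    have "(\<Sum>m | m < n \<and> nxt m l. g $$ (k, m)) = 0"
    proof (rule sum.neutral, clarify)
      fix m assume "m < n" "nxt m l"
      then show "g $$ (k, m) = 0" using less by (auto simp: next_in_chain_def)
    qed
    moreover have "(\<Sum>m | m < n \<and> nxt k m. g $$ (m, l)) = 0"
    proof (rule sum.neutral, clarify)
      fix m assume "m < n" "nxt k m"
      then show "g $$ (m, l) = 0"
        using less.prems b[of m] b[of k] by (intro less.hyps) (auto simp: next_in_chain_def)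
    qed
    ultimately have "g $$ (k, l) * c (chain l) = g $$ (k, l) * c (chain k)"
      using commuting_entry_eq[OF g less.prems(1,2)] by simp
    then show ?case using less.prems(3) by auto
  qed
qed

text \<open>
  Commuting with a chain matrix amounts to commuting with its nilpotent part. Each side has at most
  one summand.
\<close>

lemma commuting_neighbour_sums:
  fixes c :: "nat \<Rightarrow> 'k::field"
  assumes g: "g \<in> carrier_mat n n" "g * chain_mat n chain layer c = chain_mat n chain layer c * g"
    and kl: "k < n" "l < n"
  shows "(\<Sum>m | m < n \<and> nxt m l. g $$ (k, m)) = (\<Sum>m | m < n \<and> nxt k m. g $$ (m, l))"
proof (cases "c (chain k) = c (chain l)")
  case True
  then show ?thesis using commuting_entry_eq[OF g kl] by simp
next
  case False
  have "(\<Sum>m | m < n \<and> nxt m l. g $$ (k, m)) = 0"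
    by (intro sum.neutral ballI commuting_zero_colour[OF g]) (use False kl in \<open>auto simp: next_in_chain_def\<close>)
  moreover have "(\<Sum>m | m < n \<and> nxt k m. g $$ (m, l)) = 0"
    by (intro sum.neutral ballI commuting_zero_colour[OF g]) (use False kl in \<open>auto simp: next_in_chain_def\<close>)
  ultimately show ?thesis by simp
qed

lemma commuting_shift:
  fixes c :: "nat \<Rightarrow> 'k::field"
  assumes g: "g \<in> carrier_mat n n" "g * chain_mat n chain layer c = chain_mat n chain layer c * g"
    and kl: "k < n" "l < n" "k' < n" "l' < n" and nxt: "nxt k k'" "nxt l l'"
  shows "g $$ (k', l') = g $$ (k, l)"
proof -
  have "{m. m < n \<and> nxt m l'} = {l}" using kl nxt nxt_source_unique by blast
  moreover have "{m. m < n \<and> nxt k m} = {k'}" using kl nxt nxt_target_unique by blast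
  ultimately show ?thesis using commuting_neighbour_sums[OF g kl(1,4)] by simp
qed

text \<open>
  Shifting both the row and the column one layer down leaves the entry unchanged. When the column has
  reached layer 0 while the row has not, the entry is equal to an empty sum.
\<close>

lemma commuting_zero_layer:
  fixes c :: "nat \<Rightarrow> 'k::field"
  assumes g: "g \<in> carrier_mat n n" "g * chain_mat n chain layer c = chain_mat n chain layer c * g"
    and "k < n" "l < n" "layer l < layer k"
  shows "g $$ (k, l) = 0"
  using assms(3-5)
proof (induction "layer l" arbitrary: k l rule: less_induct)
  case less
  obtain i where i: "layer k = Suc i" using less.prems(3) by (cases "layer k") auto
  then obtain k' where k': "k' < n" "nxt k' k"
    using layer_down[OF less.prems(1) i] by (auto simp: next_in_chain_def)
  have "(\<Sum>m | m < n \<and> nxt m l. g $$ (k', m)) = 0"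
  proof (rule sum.neutral, clarify)
    fix m assume "m < n" "nxt m l"
    then show "g $$ (k', m) = 0" using k' less by (auto simp: next_in_chain_def)
  qed
  moreover have "{m. m < n \<and> nxt k' m} = {k}" using k' less.prems(1) nxt_target_unique by blast
  ultimately show ?case using commuting_neighbour_sums[OF g k'(1) less.prems(2)] by simp
qed

text \<open>
  The relations between the entries of \<open>g\<close> involve no proper sums: either the two eigenvalues agree
  or the entry vanishes, and the neighbour sums have at most one summand. So they are preserved
  although \<open>s\<close> is not additive.
\<close>

lemma entrywise_lift_commutes:
  fixes c :: "nat \<Rightarrow> 'k::field" and s :: "'k \<Rightarrow> 'r::comm_ring_1"
  assumes g: "g \<in> carrier_mat n n" "g * chain_mat n chain layer c = chain_mat n chain layer c * g"
    and s: "s 0 = 0"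
  shows "map_mat s g * chain_mat n chain layer (s \<circ> c) =
    chain_mat n chain layer (s \<circ> c) * map_mat s g"
proof -
  have "map_mat s g $$ (k, l) * (s \<circ> c) (chain l) + (\<Sum>m | m < n \<and> nxt m l. map_mat s g $$ (k, m)) =
      map_mat s g $$ (k, l) * (s \<circ> c) (chain k) + (\<Sum>m | m < n \<and> nxt k m. map_mat s g $$ (m, l))"
    if kl: "k < n" "l < n" for k l
  proof -
    have "g $$ (k, l) = 0 \<or> c (chain k) = c (chain l)"
      using commuting_zero_colour[OF g kl] by blast
    then have "s (g $$ (k, l)) * s (c (chain l)) = s (g $$ (k, l)) * s (c (chain k))"
      using s by auto
    moreover have "(\<Sum>m | m < n \<and> nxt m l. map_mat s g $$ (k, m)) = (\<Sum>m | m < n \<and> nxt m l. s (g $$ (k, m)))"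
      "(\<Sum>m | m < n \<and> nxt k m. map_mat s g $$ (m, l)) = (\<Sum>m | m < n \<and> nxt k m. s (g $$ (m, l)))"
      using g kl by (auto intro!: sum.cong)
    ultimately show ?thesis
      using commuting_neighbour_sums[OF g kl] g kl
        sum_sources_lift[of s "\<lambda>m. g $$ (k, m)" l, OF s]
        sum_targets_lift[of s "\<lambda>m. g $$ (m, l)" k, OF s]
      by simp
  qed
  then show ?thesis using commutes_iff[of "map_mat s g"] g by simp
qed

text \<open>
  The determinant is the product of those of the diagonal blocks on the layers. Since all lengths are
  multiples of \<open>p\<close>, every chain that meets one of the layers \<open>j p, ..., j p + p - 1\<close> meets all of
  them, and the shift identifies the blocks on these \<open>p\<close> layers.
\<close>

lemma det_eq_power:
  fixes A :: "'r::comm_ring_1 mat"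
  assumes A: "A \<in> carrier_mat n n"
    and zero: "\<And>k l. k < n \<Longrightarrow> l < n \<Longrightarrow> layer l < layer k \<Longrightarrow> A $$ (k, l) = 0"
    and shift: "\<And>k l k' l'. k < n \<Longrightarrow> l < n \<Longrightarrow> k' < n \<Longrightarrow> l' < n \<Longrightarrow> nxt k k' \<Longrightarrow> nxt l l' \<Longrightarrow>
      A $$ (k', l') = A $$ (k, l)"
    and p: "p > 0" "\<And>a. p dvd card {k. k < n \<and> chain k = a}"
  shows "\<exists>h. det A = h ^ p"
proof -
  define D where "D i = set_det {k \<in> {..<n}. layer k = i} (\<lambda>k l. A $$ (k, l))" for i
  obtain b where b: "\<And>k. k < n \<Longrightarrow> layer k < b" using bounded_layers by blast
  have D_Suc: "D (Suc i) = D i" if i: "\<not> p dvd Suc i" for i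
  proof -
    have ex: "\<exists>l<n. nxt k l" if k: "k \<in> {k \<in> {..<n}. layer k = i}" for k
    proof -
      let ?C = "{l. l < n \<and> chain l = chain k}"
      have "i \<in> layer ` ?C" using k by auto
      then have "i < card ?C" by (simp add: layers_of_chain)
      moreover have "card ?C \<noteq> Suc i" using p(2)[of "chain k"] i by auto
      ultimately have "Suc i < card ?C" by simp
      then have "Suc i \<in> layer ` ?C" by (simp add: layers_of_chain)
      then show ?thesis using k by (force simp: next_in_chain_def)
    qed
    \<comment> \<open>The shift is a bijection between the two layers, as no chain ends at layer \<open>i\<close>.\<close>
    define h where "h k = (SOME l. l < n \<and> nxt k l)" for k
    have h: "h k < n" "nxt k (h k)" if "k \<in> {k \<in> {..<n}. layer k = i}" for k
      using someI_ex[of "\<lambda>l. l < n \<and> nxt k l"] ex[OF that] by (auto simp: h_def)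
    have "bij_betw h {k \<in> {..<n}. layer k = i} {k \<in> {..<n}. layer k = Suc i}"
      unfolding bij_betw_def
    proof
      show "inj_on h {k \<in> {..<n}. layer k = i}"
      proof (rule inj_onI)
        fix k l assume kl: "k \<in> {k \<in> {..<n}. layer k = i}" "l \<in> {k \<in> {..<n}. layer k = i}" "h k = h l"
        then show "k = l" using h[OF kl(1)] h[OF kl(2)] nxt_source_unique[of k l "h k"] by simp
      qed
      show "h ` {k \<in> {..<n}. layer k = i} = {k \<in> {..<n}. layer k = Suc i}"
      proof (intro equalityI subsetI)
        fix l assume "l \<in> h ` {k \<in> {..<n}. layer k = i}"
        then show "l \<in> {k \<in> {..<n}. layer k = Suc i}" using h by (force simp: next_in_chain_def)
      next
        fix l assume l: "l \<in> {k \<in> {..<n}. layer k = Suc i}"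
        then obtain k where k: "k < n" "nxt k l" "layer k = i"
          using layer_down[of l i] by (auto simp: next_in_chain_def)
        then have "h k = l" using h[of k] l nxt_target_unique[of "h k" l k] by simp
        then show "l \<in> h ` {k \<in> {..<n}. layer k = i}" using k by force
      qed
    qed
    then show ?thesis
      unfolding D_def by (rule set_det_reindex[rotated]) (use h in \<open>auto intro: shift\<close>)
  qed
  have D_block: "D (j * p + t) = D (j * p)" if "t < p" for j t
    using that
  proof (induction t)
    case (Suc t)
    have "\<not> p dvd Suc (j * p + t)"
      using Suc.prems by (metis add_Suc_right dvd_add_right_iff dvd_triv_right nat_dvd_not_less zero_less_Suc)
    then show ?case using D_Suc Suc by simp
  qed simp
  \<comment> \<open>The layers are padded with empty ones, of determinant 1, up to a multiple of \<open>p\<close>.\<close>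
  have "det A = (\<Prod>i<b*p. D i)"
  proof -
    have "layer k < b * p" if "k < n" for k
      using b[OF that] p(1) by (metis less_le_trans mult.right_neutral mult_le_mono2 Suc_leI One_nat_def)
    then show ?thesis
      unfolding det_eq_set_det[OF A] D_def by (intro set_det_layers) (auto intro: zero)
  qed
  also have "\<dots> = (\<Prod>j<b. prod D {j*p..<j*p+p})" by (rule prod.nat_group[symmetric])
  also have "\<dots> = (\<Prod>j<b. D (j * p) ^ p)"
  proof (rule prod.cong[OF refl])
    fix j
    have "prod D {j*p..<j*p+p} = (\<Prod>i\<in>{j*p..<j*p+p}. D (j * p))"
      by (rule prod.cong[OF refl]) (metis D_block atLeastLessThan_iff le_Suc_ex nat_add_left_cancel_less)
    then show "prod D {j*p..<j*p+p} = D (j * p) ^ p" by simp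
  qed
  also have "\<dots> = (\<Prod>j<b. D (j * p)) ^ p" by (rule prod_power_distrib[symmetric])
  finally show ?thesis by blast
qed

text \<open>
  Being scalar on every chain, these matrices commute with all chain matrices. They serve to adjust
  determinants inside a centralizer.
\<close>

definition chain_scaling :: "nat \<Rightarrow> 'r::comm_ring_1 \<Rightarrow> 'r mat" where
  "chain_scaling a u = mat n n (\<lambda>(k, l). if k = l then (if chain k = a then u else 1) else 0)"

lemma chain_scaling_carrier [simp]: "chain_scaling a u \<in> carrier_mat n n"
  by (simp add: chain_scaling_def)

lemma det_chain_scaling: "det (chain_scaling a u) = u ^ card {k. k < n \<and> chain k = a}"
proof -
  have "det (chain_scaling a u) = prod_list (diag_mat (chain_scaling a u))"
    by (rule det_upper_triangular[of _ n]) (auto simp: chain_scaling_def)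
  also have "\<dots> = (\<Prod>k<n. if chain k = a then u else 1)"
    by (simp add: prod_list_diag_prod chain_scaling_def atLeast0LessThan)
  also have "\<dots> = u ^ card {k. k < n \<and> chain k = a}"
    by (simp add: prod.inter_filter[symmetric])
  finally show ?thesis .
qed

lemma chain_scaling_commutes:
  "chain_scaling a u * chain_mat n chain layer c = chain_mat n chain layer c * chain_scaling a u"
  unfolding commutes_iff[OF chain_scaling_carrier]
proof (intro allI impI)
  fix k l assume kl: "k < n" "l < n"
  have "(\<Sum>m | m < n \<and> nxt m l. chain_scaling a u $$ (k, m)) =
      (\<Sum>m | m < n \<and> nxt m l. if m = k then (if chain k = a then u else 1) else 0)"
    by (rule sum.cong) (use kl in \<open>auto simp: chain_scaling_def\<close>)
  moreover have "(\<Sum>m | m < n \<and> nxt k m. chain_scaling a u $$ (m, l)) =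
      (\<Sum>m | m < n \<and> nxt k m. if m = l then (if chain l = a then u else 1) else 0)"
    by (rule sum.cong) (use kl in \<open>auto simp: chain_scaling_def\<close>)
  ultimately have "(\<Sum>m | m < n \<and> nxt m l. chain_scaling a u $$ (k, m)) =
      (\<Sum>m | m < n \<and> nxt k m. chain_scaling a u $$ (m, l))"
    using kl by (simp add: next_in_chain_def)
  moreover have "chain_scaling a u $$ (k, l) * c (chain l) = chain_scaling a u $$ (k, l) * c (chain k)"
    using kl by (simp add: chain_scaling_def)
  ultimately show "chain_scaling a u $$ (k, l) * c (chain l) + (\<Sum>m | m < n \<and> nxt m l. chain_scaling a u $$ (k, m)) =
      chain_scaling a u $$ (k, l) * c (chain k) + (\<Sum>m | m < n \<and> nxt k m. chain_scaling a u $$ (m, l))"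
    by simp
qed

end

section \<open>Weyr matrices as chain matrices\<close>

lemma weyr_index_decompose:
  fixes ns :: "nat list"
  assumes "k < sum_list ns"
  shows "\<exists>i a. i < length ns \<and> a < ns ! i \<and> k = sum_list (take i ns) + a"
  using assms
proof (induction ns arbitrary: k)
  case (Cons m ns)
  show ?case
  proof (cases "k < m")
    case True
    then show ?thesis by (intro exI[of _ 0] exI[of _ k]) simp
  next
    case False
    then have "k - m < sum_list ns" using Cons.prems by simp
    then obtain i a where "i < length ns" "a < ns ! i" "k - m = sum_list (take i ns) + a"
      using Cons.IH by blast
    then show ?thesis using False by (intro exI[of _ "Suc i"] exI[of _ a]) simp
  qed
qed simp

lemma sum_list_take_mono:
  fixes ns :: "nat list"
  assumes "i \<le> j"
  shows "sum_list (take i ns) \<le> sum_list (take j ns)"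
proof -
  have "take j ns = take i ns @ take (j - i) (drop i ns)"
    using assms by (metis le_add_diff_inverse take_add)
  then show ?thesis by simp
qed

lemma sum_list_take_add_less:
  fixes ns :: "nat list"
  assumes "i < j" "i < length ns" "a < ns ! i"
  shows "sum_list (take i ns) + a < sum_list (take j ns)"
  using sum_list_take_mono[of "Suc i" j ns] assms by (simp add: take_Suc_conv_app_nth)

lemma weyr_index_unique:
  fixes ns :: "nat list"
  assumes "i < length ns" "a < ns ! i" "j < length ns" "b < ns ! j"
    and "sum_list (take i ns) + a = sum_list (take j ns) + b"
  shows "i = j \<and> a = b"
proof -
  have "i = j"
    using sum_list_take_add_less[of i j ns a] sum_list_take_add_less[of j i ns b] assms
    by (cases i j rule: linorder_cases) auto
  then show ?thesis using assms by simp
qed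

text \<open>
  The layer of an index is the number of its block and its chain is its position inside the block. As
  the superdiagonal blocks are identity matrices followed by zero rows, position \<open>a\<close> of each block is
  joined to position \<open>a\<close> of the next one. As the block sizes decrease, a chain that reaches some
  block passes through all the previous ones.
\<close>

lemma basic_weyr_eq_chain_mat:
  fixes W :: "'r::comm_ring_1 mat"
  assumes "basic_weyr c W"
  shows "\<exists>n chain layer. chain_labelling n chain layer \<and> W = chain_mat n chain layer (\<lambda>_. c)"
proof -
  obtain ns where sorted: "sorted_wrt (\<ge>) ns"
    and W: "W \<in> carrier_mat (sum_list ns) (sum_list ns)"
    and diag: "\<And>i. i < length ns \<Longrightarrow> mat_block ns W i i = c \<cdot>\<^sub>m 1\<^sub>m (ns ! i)"
    and super: "\<And>i. Suc i < length ns \<Longrightarrow> mat_block ns W i (Suc i) =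
           1\<^sub>m (ns ! Suc i) @\<^sub>r 0\<^sub>m (ns ! i - ns ! Suc i) (ns ! Suc i)"
    and other: "\<And>i j. i < length ns \<Longrightarrow> j < length ns \<Longrightarrow> j \<notin> {i, Suc i} \<Longrightarrow>
         mat_block ns W i j = 0\<^sub>m (ns ! i) (ns ! j)"
    using assms unfolding basic_weyr_def by blast
  define n where "n = sum_list ns"
  have "\<forall>k. \<exists>i a. k < n \<longrightarrow> i < length ns \<and> a < ns ! i \<and> k = sum_list (take i ns) + a"
    using weyr_index_decompose unfolding n_def by blast
  then obtain layer chain where lab:
      "\<And>k. k < n \<Longrightarrow> layer k < length ns" "\<And>k. k < n \<Longrightarrow> chain k < ns ! layer k"
      "\<And>k. k < n \<Longrightarrow> k = sum_list (take (layer k) ns) + chain k"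
    by metis
  have antimono: "ns ! Suc i \<le> ns ! i" if "Suc i < length ns" for i
    using sorted that by (simp add: sorted_wrt_iff_nth_less)
  have "chain_labelling n chain layer"
  proof
    fix k l assume "k < n" "l < n" "chain k = chain l" "layer k = layer l"
    then show "k = l" using lab(3)[of k] lab(3)[of l] by simp
  next
    fix k i assume k: "k < n" "layer k = Suc i"
    have i: "Suc i < length ns" "chain k < ns ! i"
      using lab(1,2)[OF k(1)] antimono[of i] k(2) by auto
    define l where "l = sum_list (take i ns) + chain k"
    have "l < sum_list (take (length ns) ns)"
      unfolding l_def by (rule sum_list_take_add_less) (use i in auto)
    then have l: "l < n" by (simp add: n_def)
    have "i = layer l \<and> chain k = chain l"
      by (rule weyr_index_unique) (use i lab[OF l] l_def in auto)
    then show "\<exists>l<n. chain l = chain k \<and> layer l = i" using l by auto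
  qed
  moreover have "W = chain_mat n chain layer (\<lambda>_. c)"
  proof (rule eq_matI)
    show "dim_row W = dim_row (chain_mat n chain layer (\<lambda>_. c))"
      "dim_col W = dim_col (chain_mat n chain layer (\<lambda>_. c))"
      using W by (auto simp: n_def chain_mat_def)
  next
    fix k l assume "k < dim_row (chain_mat n chain layer (\<lambda>_. c))"
      "l < dim_col (chain_mat n chain layer (\<lambda>_. c))"
    then have k: "k < n" and l: "l < n" by (auto simp: chain_mat_def)
    let ?i = "layer k" and ?j = "layer l" and ?a = "chain k" and ?b = "chain l"
    have entry: "W $$ (k, l) = mat_block ns W ?i ?j $$ (?a, ?b)"
      using lab[OF k] lab[OF l] by (simp add: mat_block_def)
    have kl: "k = l \<longleftrightarrow> ?i = ?j \<and> ?a = ?b" using lab(3)[OF k] lab(3)[OF l] by metis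
    consider "?j = ?i" | "?j = Suc ?i" | "?j \<notin> {?i, Suc ?i}" by blast
    then have "W $$ (k, l) =
        (if k = l then c else if next_in_chain chain layer k l then 1 else 0)"
    proof cases
      case 1
      then show ?thesis
        unfolding entry using diag lab[OF k] lab[OF l] by (auto simp: kl next_in_chain_def)
    next
      case 2
      then have "Suc ?i < length ns" using lab(1)[OF l] by simp
      then show ?thesis
        unfolding entry using 2 super[of ?i] antimono[of ?i] lab[OF k] lab[OF l]
        by (auto simp: kl next_in_chain_def append_rows_def)
    next
      case 3
      then show ?thesis
        unfolding entry using other[of ?i ?j] lab[OF k] lab[OF l] by (auto simp: kl next_in_chain_def)
    qed
    then show "W $$ (k, l) = chain_mat n chain layer (\<lambda>_. c) $$ (k, l)"
      using k l by (simp add: chain_mat_def)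
  qed
  ultimately show ?thesis by blast
qed

text \<open>Even and odd numbers keep the chains of the two summands apart.\<close>

lemma chain_mat_direct_sum:
  fixes c1 c2 :: "nat \<Rightarrow> 'r::comm_ring_1"
  assumes 1: "chain_labelling n1 chain1 layer1" and 2: "chain_labelling n2 chain2 layer2"
  shows "\<exists>chain layer c. chain_labelling (n1 + n2) chain layer \<and>
    four_block_mat (chain_mat n1 chain1 layer1 c1) (0\<^sub>m n1 n2) (0\<^sub>m n2 n1) (chain_mat n2 chain2 layer2 c2) =
      chain_mat (n1 + n2) chain layer c"
proof -
  interpret L1: chain_labelling n1 chain1 layer1 by fact
  interpret L2: chain_labelling n2 chain2 layer2 by fact
  define chain where "chain k = (if k < n1 then 2 * chain1 k else Suc (2 * chain2 (k - n1)))" for k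
  define layer where "layer k = (if k < n1 then layer1 k else layer2 (k - n1))" for k
  define c where "c a = (if even a then c1 (a div 2) else c2 (a div 2))" for a
  have low: "chain k = 2 * chain1 k" "layer k = layer1 k" if "k < n1" for k
    using that by (simp_all add: chain_def layer_def)
  have high: "chain k = Suc (2 * chain2 (k - n1))" "layer k = layer2 (k - n1)" if "\<not> k < n1" for k
    using that by (simp_all add: chain_def layer_def)
  have mixed: "chain k \<noteq> chain l" if "k < n1 \<longleftrightarrow> \<not> l < n1" for k l
  proof -
    have "even (chain k) \<longleftrightarrow> odd (chain l)" using that by (auto simp: chain_def)
    then show ?thesis by auto
  qed
  have "chain_labelling (n1 + n2) chain layer"
  proof
    fix k l assume kl: "k < n1 + n2" "l < n1 + n2" "chain k = chain l" "layer k = layer l"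
    show "k = l"
    proof (cases "k < n1")
      case True
      then have "l < n1" using mixed kl(3) by blast
      then show ?thesis using L1.label_inj[of k l] True kl by (simp add: low)
    next
      case False
      then have "\<not> l < n1" using mixed kl(3) by blast
      then show ?thesis using L2.label_inj[of "k - n1" "l - n1"] False kl
        by (simp add: high) linarith
    qed
  next
    fix k i assume k: "k < n1 + n2" "layer k = Suc i"
    show "\<exists>l<n1 + n2. chain l = chain k \<and> layer l = i"
    proof (cases "k < n1")
      case True
      then obtain l where "l < n1" "chain1 l = chain1 k" "layer1 l = i"
        using L1.layer_down k(2) by (metis low(2))
      then show ?thesis using True by (intro exI[of _ l]) (simp add: low)
    next
      case False
      then have "k - n1 < n2" "layer2 (k - n1) = Suc i" using k by (simp_all add: high)
      then obtain l where "l < n2" "chain2 l = chain2 (k - n1)" "layer2 l = i"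
        using L2.layer_down by blast
      then show ?thesis using False by (intro exI[of _ "n1 + l"]) (simp add: high)
    qed
  qed
  moreover have "four_block_mat (chain_mat n1 chain1 layer1 c1) (0\<^sub>m n1 n2) (0\<^sub>m n2 n1)
      (chain_mat n2 chain2 layer2 c2) = chain_mat (n1 + n2) chain layer c" (is "?F = _")
  proof (rule eq_matI)
    fix k l assume "k < dim_row (chain_mat (n1 + n2) chain layer c)"
      "l < dim_col (chain_mat (n1 + n2) chain layer c)"
    then have kl: "k < n1 + n2" "l < n1 + n2" by (simp_all add: chain_mat_def)
    show "?F $$ (k, l) = chain_mat (n1 + n2) chain layer c $$ (k, l)"
    proof (cases "k < n1 \<longleftrightarrow> l < n1")
      case True
      show ?thesis
      proof (cases "k < n1")
        case k: True
        then have "l < n1" using True by simp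
        then show ?thesis using k by (simp add: chain_mat_def next_in_chain_def low c_def)
      next
        case k: False
        then have "\<not> l < n1" using True by simp
        then show ?thesis using k kl by (auto simp: chain_mat_def next_in_chain_def high c_def)
      qed
    next
      case False
      then show ?thesis using kl mixed[of l k] by (auto simp: chain_mat_def next_in_chain_def)
    qed
  qed (simp_all add: chain_mat_def)
  ultimately show ?thesis by blast
qed

lemma weyr_form_eq_chain_mat:
  fixes A :: "'r::comm_ring_1 mat"
  assumes "weyr_form A"
  shows "\<exists>n chain layer c. chain_labelling n chain layer \<and> A = chain_mat n chain layer c"
proof -
  obtain cs Ws where Ws: "list_all2 basic_weyr cs Ws" and A: "A = diag_block_mat Ws"
    using assms unfolding weyr_form_def by blast
  from Ws have "\<exists>n chain layer c. chain_labelling n chain layer \<and>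
      diag_block_mat Ws = chain_mat n chain layer c"
  proof (induction rule: list_all2_induct)
    case Nil
    have "chain_labelling 0 (\<lambda>_. 0) (\<lambda>_. 0)" by unfold_locales auto
    moreover have "diag_block_mat [] = chain_mat 0 (\<lambda>_. 0) (\<lambda>_. 0) (\<lambda>_. 0 :: 'r)"
      by (auto simp: chain_mat_def)
    ultimately show ?case by blast
  next
    case (Cons c cs W Ws)
    obtain n1 chain1 layer1 where 1: "chain_labelling n1 chain1 layer1"
        "W = chain_mat n1 chain1 layer1 (\<lambda>_. c)"
      using basic_weyr_eq_chain_mat[OF Cons.hyps(1)] by blast
    obtain n2 chain2 layer2 c2 where 2: "chain_labelling n2 chain2 layer2"
        "diag_block_mat Ws = chain_mat n2 chain2 layer2 c2"
      using Cons.IH by blast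
    have "diag_block_mat (W # Ws) = four_block_mat (chain_mat n1 chain1 layer1 (\<lambda>_. c))
        (0\<^sub>m n1 n2) (0\<^sub>m n2 n1) (chain_mat n2 chain2 layer2 c2)"
      by (simp add: 1(2) 2(2) Let_def chain_mat_def)
    then show ?case using chain_mat_direct_sum[OF 1(1) 2(1)] by metis
  qed
  then show ?thesis by (simp add: A)
qed

section \<open>Powers modulo the square of the maximal ideal\<close>

interpretation reduction: comm_ring_hom
  "reduction :: 'a::discrete_valuation_ring dvr_mod2 \<Rightarrow> 'a residue_field"
  by unfold_locales (simp_all add: reduction_hom)

text \<open>The binomial expansion stops after the linear term because \<open>d\<close> has square zero.\<close>

lemma power_add_kernel:
  fixes b d :: "'a::discrete_valuation_ring dvr_mod2"
  assumes "reduction d = 0"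
  shows "(b + d) ^ r = b ^ r + of_nat r * d * b ^ (r - 1)"
proof (induction r)
  case (Suc r)
  have dd: "d * d = 0" using reduction_kernel_mult[OF assms assms] .
  have b: "of_nat r * d * (b * b ^ (r - 1)) = of_nat r * d * b ^ r" by (cases r) auto
  have "(b + d) ^ Suc r = (b + d) * (b ^ r + of_nat r * d * b ^ (r - 1))"
    using Suc by simp
  also have "\<dots> = b ^ Suc r + d * b ^ r + of_nat r * d * (b * b ^ (r - 1)) +
      of_nat r * (d * d) * b ^ (r - 1)"
    by (simp add: algebra_simps)
  also have "\<dots> = b ^ Suc r + of_nat (Suc r) * d * b ^ (Suc r - 1)"
    unfolding b dd by (simp add: algebra_simps)
  finally show ?case .
qed simp

text \<open>
  Here \<open>r\<close> itself lies in the maximal ideal, so the linear term of the expansion of \<open>a ^ r\<close> around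
  \<open>b\<close> is a product of two elements of the kernel.
\<close>

lemma power_eq_if_char_dvd:
  fixes a b :: "'a::discrete_valuation_ring dvr_mod2"
  assumes "of_nat r = (0 :: 'a residue_field)" "reduction a = reduction b"
  shows "a ^ r = b ^ r"
proof -
  have d: "reduction (a - b) = 0" using assms(2) by (simp add: reduction.hom_minus)
  have "reduction (of_nat r :: 'a dvr_mod2) = 0" using assms(1) by (simp add: reduction_of_nat)
  then have "of_nat r * (a - b) = 0" using d by (rule reduction_kernel_mult)
  then show ?thesis using power_add_kernel[OF d, of b r] by simp
qed

text \<open>
  With \<open>d = 1 + e\<close> and \<open>m\<close> a lift of \<open>1/r\<close>, the element \<open>u = 1 - m e\<close> satisfies \<open>u ^ r = 1 - e\<close>,
  which is the inverse of \<open>d\<close>.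
\<close>

lemma root_of_one_unit:
  fixes d :: "'a::discrete_valuation_ring dvr_mod2"
  assumes "of_nat r \<noteq> (0 :: 'a residue_field)" "reduction d = 1"
  shows "\<exists>u. reduction u = 1 \<and> u ^ r * d = 1"
proof -
  obtain m :: "'a dvr_mod2" where m: "reduction m = inverse (of_nat r)" using surj_reduction by blast
  define e where "e = d - 1"
  have e: "reduction e = 0" using assms(2) by (simp add: e_def reduction.hom_minus)
  have "reduction (of_nat r * m - 1) = 0"
    using assms(1) m by (simp add: reduction.hom_minus reduction_hom reduction_of_nat)
  then have "(of_nat r * m - 1) * e = 0" using e by (rule reduction_kernel_mult)
  then have rme: "of_nat r * (m * e) = e" by (simp add: algebra_simps)
  have "reduction (- (m * e)) = 0" using e by (simp add: reduction.hom_uminus reduction_hom)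
  then have "(1 + - (m * e)) ^ r = 1 - e" using power_add_kernel[of "- (m * e)" 1 r] rme by simp
  moreover have "(1 - e) * d = 1"
    using reduction_kernel_mult[OF e e] by (simp add: e_def algebra_simps)
  moreover have "reduction (1 + - (m * e)) = 1" using e by (simp add: reduction.hom_minus reduction_hom)
  ultimately show ?thesis by metis
qed

section \<open>Lifting centralizers\<close>

lemma the_section_facts:
  assumes "finite (UNIV :: 'a::discrete_valuation_ring residue_field set)"
  shows "the_section (0 :: 'a residue_field) = 0" "the_section (1 :: 'a residue_field) = 1"
    "reduction (the_section (a :: 'a residue_field)) = a"
proof -
  have s: "mult_section (the_section :: 'a residue_field \<Rightarrow> 'a dvr_mod2)"
    by (rule mult_section_the_section[OF assms])
  then show "the_section (0 :: 'a residue_field) = 0" by (simp add: mult_section_def)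
  show "reduction (the_section a) = a" using s by (cases "a = 0") (auto simp: mult_section_def)
  have "the_section (1 :: 'a residue_field) dvd 1" using s by (simp add: mult_section_def)
  then obtain y where y: "1 = the_section (1 :: 'a residue_field) * y" by (auto simp: dvd_def)
  have "the_section (1 :: 'a residue_field) * the_section 1 = the_section (1 * 1)"
    using s by (metis mult_section_def one_neq_zero)
  then show "the_section (1 :: 'a residue_field) = 1" using y by (metis mult.assoc mult.right_neutral)
qed

lemma the_section_power:
  fixes a :: "'a::discrete_valuation_ring residue_field"
  assumes fin: "finite (UNIV :: 'a residue_field set)"
  shows "the_section (a ^ k) = the_section a ^ k"
proof (induction k)
  case (Suc k)
  have "the_section (a * a ^ k) = the_section a * the_section (a ^ k)"
    using mult_section_the_section[OF fin]
    by (cases "a = 0") (auto simp: mult_section_def)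
  then show ?case using Suc by simp
qed (simp add: the_section_facts(2)[OF fin])

lemma map_chain_mat:
  assumes "s 0 = 0" "s 1 = 1"
  shows "map_mat s (chain_mat n chain layer c) = chain_mat n chain layer (s \<circ> c)"
  using assms by (intro eq_matI) (auto simp: chain_mat_def)

text \<open>
  The entrywise lift of \<open>g\<close> commutes with the lifted matrix. Its determinant is corrected by scaling
  a chain of length prime to the characteristic, and is 1 if there is no such chain.
\<close>

lemma lift_centralizer_of_chain_mat:
  fixes c :: "nat \<Rightarrow> 'a::discrete_valuation_ring residue_field"
  assumes fin: "finite (UNIV :: 'a residue_field set)"
    and lab: "chain_labelling n chain layer"
    and g: "g \<in> SL_centralizer n (chain_mat n chain layer c)"
  shows "\<exists>h \<in> SL_centralizer n (chain_mat n chain layer (the_section \<circ> c)). map_mat reduction h = g"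
proof -
  interpret chain_labelling n chain layer by fact
  define x where "x = chain_mat n chain layer (the_section \<circ> c)"
  define h where "h = map_mat the_section g"
  have gn: "g \<in> carrier_mat n n" and gx: "g * chain_mat n chain layer c = chain_mat n chain layer c * g"
    and "det g = 1"
    using g by (auto simp: SL_centralizer_def)
  have hn: "h \<in> carrier_mat n n" using gn by (simp add: h_def)
  have hx: "h * x = x * h"
    unfolding h_def x_def by (rule entrywise_lift_commutes[OF gn gx]) (rule the_section_facts(1)[OF fin])
  have red: "map_mat reduction h = g"
    using gn by (intro eq_matI) (auto simp: h_def the_section_facts(3)[OF fin])
  have d: "reduction (det h) = 1" using \<open>det g = 1\<close> red by (metis reduction.hom_det)
  show ?thesis
  proof (cases "\<exists>a. of_nat (card {k. k < n \<and> chain k = a}) \<noteq> (0 :: 'a residue_field)")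
    case True
    then obtain a where a: "of_nat (card {k. k < n \<and> chain k = a}) \<noteq> (0 :: 'a residue_field)" ..
    obtain u where u: "reduction u = 1" "u ^ card {k. k < n \<and> chain k = a} * det h = 1"
      using root_of_one_unit[OF a d] by blast
    let ?t = "chain_scaling a u"
    have "?t * h \<in> carrier_mat n n" by (rule mult_carrier_mat[OF chain_scaling_carrier hn])
    moreover have "det (?t * h) = 1"
      using u(2) by (simp add: det_mult[OF chain_scaling_carrier hn] det_chain_scaling)
    moreover have "(?t * h) * x = x * (?t * h)"
    proof -
      have xn: "x \<in> carrier_mat n n" by (simp add: x_def)
      have "(?t * h) * x = ?t * (x * h)"
        by (simp add: assoc_mult_mat[OF chain_scaling_carrier hn xn] hx)
      also have "\<dots> = (?t * x) * h" by (rule assoc_mult_mat[OF chain_scaling_carrier xn hn, symmetric])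
      also have "\<dots> = x * (?t * h)"
        unfolding x_def chain_scaling_commutes
        by (rule assoc_mult_mat[OF chain_mat_carrier chain_scaling_carrier hn])
      finally show ?thesis .
    qed
    moreover have "map_mat reduction (?t * h) = g"
    proof -
      have "map_mat reduction ?t = 1\<^sub>m n"
        using u(1) by (intro eq_matI) (auto simp: chain_scaling_def)
      then show ?thesis
        using gn by (simp add: reduction.mat_hom_mult[OF chain_scaling_carrier hn] red)
    qed
    ultimately show ?thesis unfolding x_def SL_centralizer_def by blast
  next
    case False
    define p where "p = CHAR('a residue_field)"
    have p0: "p > 0" unfolding p_def by (rule finite_imp_CHAR_pos[OF fin])
    have p: "p dvd card {k. k < n \<and> chain k = a}" for a
      using False by (simp add: p_def of_nat_eq_0_iff_char_dvd)
    have "\<exists>e. det h = e ^ p"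
    proof (rule det_eq_power[OF hn _ _ p0 p])
      fix k l assume "k < n" "l < n" "layer l < layer k"
      then show "h $$ (k, l) = 0"
        using commuting_zero_layer[OF gn gx] gn by (simp add: h_def the_section_facts(1)[OF fin])
    next
      fix k l k' l' assume "k < n" "l < n" "k' < n" "l' < n" "nxt k k'" "nxt l l'"
      then show "h $$ (k', l') = h $$ (k, l)"
        using commuting_shift[OF gn gx] gn by (simp add: h_def)
    qed
    then obtain e where e: "det h = e ^ p" ..
    have "of_nat p = (0 :: 'a residue_field)" by (simp add: p_def)
    then have p_pow: "e ^ p = f ^ p" if "reduction e = reduction f" for e f :: "'a dvr_mod2"
      using that by (rule power_eq_if_char_dvd)
    have "reduction e ^ p = 1" using d by (simp add: e reduction_power)
    \<comment> \<open>Replacing \<open>e\<close> by the multiplicative lift of its reduction does not change its \<open>p\<close>-th power.\<close>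
    have "det h = the_section (reduction e) ^ p"
      unfolding e by (rule p_pow) (simp add: the_section_facts(3)[OF fin])
    also have "\<dots> = the_section (reduction e ^ p)" by (rule the_section_power[OF fin, symmetric])
    also have "\<dots> = 1" using \<open>reduction e ^ p = 1\<close> by (simp add: the_section_facts(2)[OF fin])
    finally have "det h = 1" .
    then show ?thesis using hn hx red unfolding x_def SL_centralizer_def by blast
  qed
qed

theorem theorem3p1:
  fixes n :: nat and x :: "'a::complete_dvr residue_field mat"
  assumes "n \<ge> 2"
    and "finite (UNIV :: 'a residue_field set)"
    and "x \<in> carrier_mat n n"
    and "weyr_form x"
  shows "map_mat reduction ` SL_centralizer n (map_mat the_section x) = SL_centralizer n x"
proof
  note fin = assms(2)
  have red_x: "map_mat reduction (map_mat the_section x) = x"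
    by (intro eq_matI) (auto simp: the_section_facts(3)[OF fin])
  show "map_mat reduction ` SL_centralizer n (map_mat the_section x) \<subseteq> SL_centralizer n x"
  proof (rule image_subsetI)
    fix h assume "h \<in> SL_centralizer n (map_mat the_section x)"
    then have h: "h \<in> carrier_mat n n" "det h = 1"
        "h * map_mat the_section x = map_mat the_section x * h"
      by (auto simp: SL_centralizer_def)
    have sx: "map_mat the_section x \<in> carrier_mat n n" using assms(3) by simp
    have "map_mat reduction h * x = x * map_mat reduction h"
      using reduction.mat_hom_mult[OF h(1) sx] reduction.mat_hom_mult[OF sx h(1)] h(3)
      by (simp add: red_x)
    then show "map_mat reduction h \<in> SL_centralizer n x" using h by (simp add: SL_centralizer_def)
  qed
  obtain n' chain layer c where "chain_labelling n' chain layer" "x = chain_mat n' chain layer c"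
    using weyr_form_eq_chain_mat[OF assms(4)] by blast
  moreover from this have "n' = n" using assms(3) by (auto simp: chain_mat_def)
  ultimately have lab: "chain_labelling n chain layer" and x: "x = chain_mat n chain layer c" by auto
  have sx: "map_mat the_section x = chain_mat n chain layer (the_section \<circ> c)"
    unfolding x by (rule map_chain_mat) (rule the_section_facts[OF fin])+
  show "SL_centralizer n x \<subseteq> map_mat reduction ` SL_centralizer n (map_mat the_section x)"
    unfolding sx using lift_centralizer_of_chain_mat[OF fin lab] by (force simp: x)
qed

end
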